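(* Let $n\ge 2$, let $\bm X=(X_1,\dots,X_n)$ be a random vector with finite alphabets $\mathcal X_1,\dots,\mathcal X_n$ and distribution $p(\bm X)$, and for each $m\ge1$ let $\mathcal S_m=\{\bm x^{(k)}\}_{k=1}^m$ be a set of $m$ i.i.d. samples from $p$. Then, as $m\to\infty$, $$\frac1m\sum_{j=2}^{n-1}\lambda_{\mathcal K_{\mathrm H}^j}^{\mathcal K_{\mathrm T}^j}(\mathcal S_m)\longrightarrow\Omega(\bm X)\quad\text{in probability,}$$ where an empty sum is zero.
   Context: $H$ denotes Shannon entropy. Notation: $\bm X_i^j=(X_i,\dots,X_j)$, $\bm X^j=\bm X_1^j$, and $\bm X_{-j}$ is $\bm X$ with $X_j$ deleted. The O-information is $$\Omega(\bm X)=(n-2)H(\bm X)+\sum_{j=1}^n\big(H(X_j)-H(\bm X_{-j})\big).$$ For $2\le j\le n-1$, define the following classes of probability distributions on $\mathcal X_1\times\dots\times\mathcal X_n$: $$\mathcal K_{\mathrm T}^j=\{q: q(\bm X)=q(X_j)\,q(\bm X^{j-1}\mid X_j)\,q(\bm X_{j+1}^n\mid X_j)\},$$ $$\mathcal K_{\mathrm H}^j=\{q: q(\bm X)=q(X_j\mid\bm X_{-j})\,q(\bm X^{j-1})\,q(\bm X_{j+1}^n)\}.$$ That is, under $q\in\mathcal K_{\mathrm T}^j$ the vectors $\bm X^{j-1}$ and $\bm X_{j+1}^n$ are conditionally independent given $X_j$, and under $q\in\mathcal K_{\mathrm H}^j$ they are independent. The likelihood of a distribution $q$ on the sample is $\Lambda(\mathcal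 S_m;q)=\prod_{k=1}^m q(\bm x^{(k)})$, and the generalized likelihood ratio between classes $\mathcal C,\mathcal C'$ is $$\lambda_{\mathcal C'}^{\mathcal C}(\mathcal S_m)=\log\frac{\sup_{r\in\mathcal C}\Lambda(\mathcal S_m;r)}{\sup_{s\in\mathcal C'}\Lambda(\mathcal S_m;s)},$$ with the same logarithm base as in the entropy. *)

theory Defs
  imports "HOL-Probability.Probability"
begin

text \<open>
  A vector with coordinates indexed by \<open>{1..n}\<close> is a function that is \<^const>\<open>undefined\<close> outside
  \<open>{1..n}\<close>; the alphabets \<open>A 1, \<dots>, A n\<close> are sets over one common carrier type, so they may differ.
\<close>

definition vectors :: "nat \<Rightarrow> (nat \<Rightarrow> 'a set) \<Rightarrow> (nat \<Rightarrow> 'a) set" where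
  "vectors n A = Pi\<^sub>E {1..n} A"

definition dist_on :: "nat \<Rightarrow> (nat \<Rightarrow> 'a set) \<Rightarrow> (nat \<Rightarrow> 'a) pmf set" where
  "dist_on n A = {q. set_pmf q \<subseteq> vectors n A}"

text \<open>Shannon entropy (base \<open>b\<close>) of a discrete random variable; in an
  \<^locale>\<open>information_space\<close> this is the library's \<open>\<H>(Y)\<close>.\<close>

definition shannon :: "real \<Rightarrow> 'w measure \<Rightarrow> ('w \<Rightarrow> 'c) \<Rightarrow> real" where
  "shannon b N Y = prob_space.entropy N b (count_space (Y ` space N)) Y"

definition O_information :: "real \<Rightarrow> nat \<Rightarrow> 'w measure \<Rightarrow> ('w \<Rightarrow> nat \<Rightarrow> 'a) \<Rightarrow> real" where
  "O_information b n N X =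
     (real n - 2) * shannon b N X
     + (\<Sum>j=1..n. shannon b N (\<lambda>\<omega>. X \<omega> j)
                  - shannon b N (\<lambda>\<omega>. restrict (X \<omega>) ({1..n} - {j})))"

text \<open>
  \<open>marg q I x\<close> is \<open>q(X\<^sub>I = x\<^sub>I)\<close> and \<open>condm q I J x\<close> is \<open>q(X\<^sub>I = x\<^sub>I | X\<^sub>J = x\<^sub>J)\<close>. The latter is \<open>0\<close>
  where the conditioning event has probability \<open>0\<close>. At such a point \<open>pmf q x\<close> is \<open>0\<close> as well, so
  the factorisations below impose a condition only where all conditional probabilities are defined.
  For \<open>K_H\<close> this still forces \<open>X\<^sub>1,\<dots>,X\<^sub>j\<^sub>-\<^sub>1\<close> to be independent of \<open>X\<^sub>j\<^sub>+\<^sub>1,\<dots>,X\<^sub>n\<close>: summing over \<open>x\<^sub>j\<close>, the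
  product of the two marginals agrees with the joint one on the support of the latter, where it
  therefore has total mass \<open>1\<close>, so it vanishes elsewhere.
\<close>

definition marg :: "(nat \<Rightarrow> 'a) pmf \<Rightarrow> nat set \<Rightarrow> (nat \<Rightarrow> 'a) \<Rightarrow> real" where
  "marg q I x = \<P>(y in measure_pmf q. \<forall>i\<in>I. y i = x i)"

definition condm :: "(nat \<Rightarrow> 'a) pmf \<Rightarrow> nat set \<Rightarrow> nat set \<Rightarrow> (nat \<Rightarrow> 'a) \<Rightarrow> real" where
  "condm q I J x = \<P>(y in measure_pmf q. \<forall>i\<in>I. y i = x i \<bar> \<forall>i\<in>J. y i = x i)"

definition K_T :: "nat \<Rightarrow> (nat \<Rightarrow> 'a set) \<Rightarrow> nat \<Rightarrow> (nat \<Rightarrow> 'a) pmf set" where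
  "K_T n A j = {q \<in> dist_on n A. \<forall>x\<in>vectors n A.
     pmf q x = marg q {j} x * condm q {1..<j} {j} x * condm q {j<..n} {j} x}"

definition K_H :: "nat \<Rightarrow> (nat \<Rightarrow> 'a set) \<Rightarrow> nat \<Rightarrow> (nat \<Rightarrow> 'a) pmf set" where
  "K_H n A j = {q \<in> dist_on n A. \<forall>x\<in>vectors n A.
     pmf q x = condm q {j} ({1..n} - {j}) x * marg q {1..<j} x * marg q {j<..n} x}"

definition likelihood :: "nat \<Rightarrow> (nat \<Rightarrow> 'c) \<Rightarrow> 'c pmf \<Rightarrow> real" where
  "likelihood m s q = (\<Prod>k=1..m. pmf q (s k))"

definition gen_llr :: "real \<Rightarrow> 'c pmf set \<Rightarrow> 'c pmf set \<Rightarrow> nat \<Rightarrow> (nat \<Rightarrow> 'c) \<Rightarrow> real" where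
  "gen_llr b C C' m s =
     log b ((SUP r\<in>C. likelihood m s r) / (SUP r\<in>C'. likelihood m s r))"

text \<open>Since the limit is a constant, the \<open>m\<close>-th variable may live on its own space \<open>M m\<close>.\<close>

definition converges_in_prob ::
    "(nat \<Rightarrow> 'w measure) \<Rightarrow> (nat \<Rightarrow> 'w \<Rightarrow> real) \<Rightarrow> real \<Rightarrow> bool" where
  "converges_in_prob M Y c \<longleftrightarrow>
     (\<forall>\<epsilon>>0. (\<lambda>m. \<P>(\<omega> in M m. \<bar>Y m \<omega> - c\<bar> > \<epsilon>)) \<longlonglongrightarrow> 0)"

end

theory Submission
  imports Defs "HOL-Real_Asymp.Real_Asymp"
begin

text \<open>
  Let \<open>P\<close> be the empirical distribution of the sample. Members of both classes are products of
  three conditional marginals, and by Gibbs' inequality each conditional factor of the log-likelihood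
  is maximised by the corresponding conditional of \<open>P\<close>; since the resulting product is again in
  the class, the maximal log-likelihood is a sum of marginal entropies of \<open>P\<close>. The sum over \<open>j\<close> of
  the log-likelihood ratios then telescopes, and the normalised statistic is exactly the
  O-information of \<open>P\<close>. As \<open>\<Omega>\<close> is a continuous function of the point masses, Hoeffding's inequality
  for the empirical frequencies gives the convergence.
\<close>

section \<open>Marginal and conditional probabilities of subvectors\<close>

lemma marg_eq_pmf_map: "marg q I x = pmf (map_pmf (\<lambda>y. restrict y I) q) (restrict x I)"
proof -
  have "{y. \<forall>i\<in>I. y i = x i} = (\<lambda>y. restrict y I) -` {restrict x I}"
    by (auto simp: restrict_def fun_eq_iff) metis
  then show ?thesis by (simp add: marg_def pmf_map)
qed

lemma condm_eq: "condm q I J x = marg q (I \<union> J) x / marg q J x"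
  by (simp add: condm_def cond_prob_def marg_def ball_Un)

lemma marg_empty [simp]: "marg q {} x = 1"
  by (simp add: marg_def)

lemma condm_unconditional [simp]: "condm q I {} x = marg q I x"
  by (simp add: condm_eq)

lemma marg_pos: "x \<in> set_pmf q \<Longrightarrow> 0 < marg q I x"
  by (auto simp: marg_def intro: measure_pmf_posI)

lemma marg_nonneg [simp]: "0 \<le> marg q I x"
  by (simp add: marg_def)

lemma marg_antimono: "I \<subseteq> J \<Longrightarrow> marg q J x \<le> marg q I x"
  by (auto simp: marg_def intro!: measure_pmf.finite_measure_mono)

lemma condm_pos: "x \<in> set_pmf q \<Longrightarrow> 0 < condm q I J x"
  by (simp add: condm_eq marg_pos)

lemma finite_vectors: "(\<And>i. i \<in> {1..n} \<Longrightarrow> finite (A i)) \<Longrightarrow> finite (vectors n A)"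
  unfolding vectors_def by (rule finite_PiE) auto

text \<open>Members of \<open>vectors n A\<close> are \<open>undefined\<close> off
  \<open>{1..n}\<close>, so agreement on \<open>{1..n}\<close> is equality; all other functions have
  no mass under \<open>q\<close>.\<close>

lemma marg_all:
  assumes "q \<in> dist_on n A" "x \<in> vectors n A"
  shows "marg q {1..n} x = pmf q x"
proof -
  have "y = x" if "y \<in> vectors n A" "\<forall>i\<in>{1..n}. y i = x i" for y
    using that assms(2) unfolding vectors_def by (intro PiE_ext) auto
  then have "measure q {y. \<forall>i\<in>{1..n}. y i = x i} = measure q {x}"
    using assms(1) by (intro measure_prob_cong_0) (auto simp: dist_on_def set_pmf_eq)
  then show ?thesis by (simp add: marg_def measure_pmf_single)
qed

section \<open>Gibbs' inequality for conditional probabilities\<close>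

lemma integral_div_pmf:
  assumes "finite (set_pmf R)"
  shows "(\<integral>w. F w / pmf R w \<partial>measure_pmf R) = (\<Sum>w\<in>set_pmf R. F w)"
  using assms by (subst integral_measure_pmf_real[of "set_pmf R"])
    (auto simp: set_pmf_iff)

text \<open>Let \<open>?a\<close> and \<open>?c\<close> be the conditional probabilities of
  \<open>w\<close> given \<open>g w\<close> under \<open>Q\<close> and \<open>R\<close>. The bound
  ln t \<le> t - 1 at t = \<open>?a w / ?c w\<close> reduces the claim to showing that the
  \<open>R\<close>-mean of this ratio is at most 1. The support inclusion keeps the ratio positive
  on the support of \<open>R\<close>.\<close>

lemma conditional_gibbs:
  fixes Q R :: "'c pmf" and g :: "'c \<Rightarrow> 'd"
  assumes "1 < b" and fQ: "finite (set_pmf Q)" and RQ: "set_pmf R \<subseteq> set_pmf Q"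
  shows "(\<integral>w. log b (pmf Q w / pmf (map_pmf g Q) (g w)) \<partial>measure_pmf R)
           \<le> (\<integral>w. log b (pmf R w / pmf (map_pmf g R) (g w)) \<partial>measure_pmf R)"
proof -
  have fR: "finite (set_pmf R)" using fQ RQ finite_subset by blast
  note int = integrable_measure_pmf_finite[OF fR]
  let ?a = "\<lambda>w. pmf Q w / pmf (map_pmf g Q) (g w)"
  let ?c = "\<lambda>w. pmf R w / pmf (map_pmf g R) (g w)"
  let ?G = "\<lambda>v. pmf (map_pmf g R) v / pmf (map_pmf g Q) v"
  \<comment> \<open>Written this way, the denominator cancels against the weights of
    \<open>R\<close>, leaving a plain sum.\<close>
  have "(\<integral>w. ?a w / ?c w \<partial>measure_pmf R) = (\<integral>w. (pmf Q w * ?G (g w)) / pmf R w \<partial>measure_pmf R)"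
    by (simp add: field_simps)
  also have "\<dots> = (\<Sum>w\<in>set_pmf R. pmf Q w * ?G (g w))"
    by (rule integral_div_pmf[OF fR])
  also have "\<dots> \<le> (\<Sum>w\<in>set_pmf Q. pmf Q w * ?G (g w))"
    using RQ fQ by (intro sum_mono2) auto
  \<comment> \<open>\<open>?G\<close> sees \<open>w\<close> only through \<open>g w\<close>, so the
    \<open>Q\<close>-average passes to the image under \<open>g\<close>. There the denominator of
    \<open>?G\<close> cancels and only mass of \<open>map_pmf g R\<close> remains.\<close>
  also have "\<dots> = (\<integral>v. ?G v \<partial>measure_pmf (map_pmf g Q))"
    using fQ by (simp add: integral_measure_pmf_real[of "set_pmf Q"] mult.commute)
  also have "\<dots> = (\<Sum>v\<in>set_pmf (map_pmf g Q). pmf (map_pmf g R) v)"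
    using fQ by (intro integral_div_pmf) auto
  also have "\<dots> = measure (map_pmf g R) (set_pmf (map_pmf g Q))"
    using fQ by (intro measure_measure_pmf_finite[symmetric]) auto
  also have "\<dots> \<le> 1" by (rule measure_pmf.prob_le_1)
  finally have le1: "(\<integral>w. ?a w / ?c w \<partial>measure_pmf R) \<le> 1" .
  have pt: "log b (?a w) - log b (?c w) \<le> (?a w / ?c w - 1) / ln b" if "w \<in> set_pmf R" for w
  proof -
    have pos: "0 < ?a w" "0 < ?c w"
      using that RQ by (auto intro!: divide_pos_pos simp: pmf_positive_iff)
    then have "log b (?a w) - log b (?c w) = ln (?a w / ?c w) / ln b"
      using \<open>1 < b\<close> by (simp only: log_def ln_divide_pos diff_divide_distrib)
    also have "\<dots> \<le> (?a w / ?c w - 1) / ln b"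
      using \<open>1 < b\<close> by (intro divide_right_mono ln_le_minus_one divide_pos_pos[OF pos]) auto
    finally show ?thesis .
  qed
  have "(\<integral>w. log b (?a w) \<partial>measure_pmf R) - (\<integral>w. log b (?c w) \<partial>measure_pmf R)
      = (\<integral>w. log b (?a w) - log b (?c w) \<partial>measure_pmf R)"
    by (intro Bochner_Integration.integral_diff[symmetric] int)
  also have "\<dots> \<le> (\<integral>w. (?a w / ?c w - 1) / ln b \<partial>measure_pmf R)"
    using pt by (intro integral_mono_AE int) (auto simp: AE_measure_pmf_iff)
  also have "\<dots> = ((\<integral>w. ?a w / ?c w \<partial>measure_pmf R) - 1) / ln b"
    by (simp add: int del: divide_divide_eq_left divide_divide_eq_right times_divide_eq_left times_divide_eq_right)
  also have "\<dots> \<le> 0" using le1 \<open>1 < b\<close> by (intro divide_nonpos_pos) auto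
  finally show ?thesis by simp
qed

text \<open>Apply the previous inequality to the laws of the subvector on
  \<open>I \<union> J\<close>, with \<open>g\<close> the further restriction to
  \<open>J\<close>.\<close>

lemma conditional_gibbs_condm:
  assumes "1 < b" and "finite (set_pmf q)" and "set_pmf P \<subseteq> set_pmf q"
  shows "(\<integral>x. log b (condm q I J x) \<partial>measure_pmf P) \<le> (\<integral>x. log b (condm P I J x) \<partial>measure_pmf P)"
proof -
  let ?u = "\<lambda>x. restrict x (I \<union> J)" and ?g = "\<lambda>x. restrict x J"
  have *: "condm r I J x = pmf (map_pmf ?u r) (?u x) / pmf (map_pmf ?g (map_pmf ?u r)) (?g (?u x))" for r x
    by (simp add: condm_eq marg_eq_pmf_map pmf.map_comp o_def Int_absorb1)
  have "(\<integral>w. log b (pmf (map_pmf ?u q) w / pmf (map_pmf ?g (map_pmf ?u q)) (?g w)) \<partial>measure_pmf (map_pmf ?u P))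
           \<le> (\<integral>w. log b (pmf (map_pmf ?u P) w / pmf (map_pmf ?g (map_pmf ?u P)) (?g w)) \<partial>measure_pmf (map_pmf ?u P))"
    using assms by (intro conditional_gibbs) auto
  then show ?thesis unfolding * by simp
qed

section \<open>Marginal entropies and the maximal likelihood of a class\<close>

text \<open>Averaging over whole vectors, not over values of the subvector, puts the entropies for
  all \<open>I\<close> under one measure, where they can be added and subtracted.\<close>

definition marg_entropy :: "real \<Rightarrow> (nat \<Rightarrow> 'a) pmf \<Rightarrow> nat set \<Rightarrow> real" where
  "marg_entropy b q I = - (\<integral>x. log b (marg q I x) \<partial>measure_pmf q)"

lemma marg_entropy_empty [simp]: "marg_entropy b q {} = 0"
  by (simp add: marg_entropy_def)

text \<open>Chain rule: both sides are minus the conditional entropy of the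
  \<open>I\<close>-coordinates given the \<open>J\<close>-coordinates.\<close>

lemma integral_log_condm:
  assumes "1 < b" "finite (set_pmf P)"
  shows "(\<integral>x. log b (condm P I J x) \<partial>measure_pmf P) = marg_entropy b P J - marg_entropy b P (I \<union> J)"
proof -
  note int = integrable_measure_pmf_finite[OF assms(2)]
  have "(\<integral>x. log b (condm P I J x) \<partial>measure_pmf P)
      = (\<integral>x. log b (marg P (I \<union> J) x) - log b (marg P J x) \<partial>measure_pmf P)"
    using assms by (intro integral_cong_AE)
      (auto simp: AE_measure_pmf_iff condm_eq log_divide_pos marg_pos)
  also have "\<dots> = marg_entropy b P J - marg_entropy b P (I \<union> J)"
    by (simp add: int marg_entropy_def)
  finally show ?thesis .
qed

definition empirical :: "nat \<Rightarrow> (nat \<Rightarrow> 'c) \<Rightarrow> 'c pmf" where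
  "empirical m s = map_pmf s (pmf_of_set {1..m})"

lemma set_empirical: "1 \<le> m \<Longrightarrow> set_pmf (empirical m s) = s ` {1..m}"
  by (simp add: empirical_def)

text \<open>The support condition makes every factor nonzero, so the logarithm turns the product
  into a sum, which is \<open>m\<close> times an empirical mean.\<close>

lemma log_likelihood:
  assumes "1 < b" "1 \<le> m" "set_pmf (empirical m s) \<subseteq> set_pmf q"
  shows "log b (likelihood m s q) = real m * (\<integral>x. log b (pmf q x) \<partial>measure_pmf (empirical m s))"
proof -
  have "pmf q (s k) \<noteq> 0" if "k \<in> {1..m}" for k
    using assms that by (force simp: set_empirical set_pmf_iff image_subset_iff)
  then have "log b (likelihood m s q) = (\<Sum>k=1..m. log b (pmf q (s k)))"
    unfolding likelihood_def log_def by (subst ln_prod) (auto simp: sum_divide_distrib)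
  also have "\<dots> = real m * (\<integral>x. log b (pmf q x) \<partial>measure_pmf (empirical m s))"
    using assms by (simp add: empirical_def integral_pmf_of_set)
  finally show ?thesis .
qed

lemma likelihood_pos_iff:
  "1 \<le> m \<Longrightarrow> 0 < likelihood m s q \<longleftrightarrow> set_pmf (empirical m s) \<subseteq> set_pmf q"
  by (auto simp: likelihood_def set_empirical prod_nonneg less_le image_subset_iff set_pmf_iff)

text \<open>Treats both classes at once: \<open>F\<close> lists the index pairs of the conditional
  factors. A member missing a sample point has likelihood 0; for the others, Gibbs' inequality
  applied to each factor bounds the likelihood by that of \<open>r\<close>, so the supremum is
  attained. The formula for \<open>r\<close> is required on the sample points only, since nothing
  else enters its likelihood.\<close>

lemma log_Sup_likelihood:
  fixes F :: "(nat set \<times> nat set) set" and m :: nat and s :: "nat \<Rightarrow> nat \<Rightarrow> 'a"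
  defines "P \<equiv> empirical m s"
  assumes b: "1 < b" and m: "1 \<le> m" and V: "finite V" "set_pmf P \<subseteq> V" and F: "finite F"
    and C: "\<And>q. q \<in> C \<Longrightarrow> set_pmf q \<subseteq> V"
      "\<And>q x. q \<in> C \<Longrightarrow> x \<in> V \<Longrightarrow> pmf q x = (\<Prod>(I,J)\<in>F. condm q I J x)"
    and r: "r \<in> C" "\<And>x. x \<in> set_pmf P \<Longrightarrow> pmf r x = (\<Prod>(I,J)\<in>F. condm P I J x)"
  shows "0 < (SUP q\<in>C. likelihood m s q)"
    and "log b (SUP q\<in>C. likelihood m s q)
       = real m * (\<Sum>(I,J)\<in>F. marg_entropy b P J - marg_entropy b P (I \<union> J))"
proof -
  have fP: "finite (set_pmf P)" using V finite_subset by blast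
  note int = integrable_measure_pmf_finite[OF fP]
  have log_prod: "(\<integral>x. log b (\<Prod>(I,J)\<in>F. condm q I J x) \<partial>measure_pmf P)
      = (\<Sum>(I,J)\<in>F. \<integral>x. log b (condm q I J x) \<partial>measure_pmf P)"
    if "set_pmf P \<subseteq> set_pmf q" for q
  proof -
    have "(\<integral>x. log b (\<Prod>(I,J)\<in>F. condm q I J x) \<partial>measure_pmf P)
        = (\<integral>x. (\<Sum>(I,J)\<in>F. log b (condm q I J x)) \<partial>measure_pmf P)"
    proof (intro integral_cong_AE, simp_all add: AE_measure_pmf_iff, intro ballI)
      fix x assume "x \<in> set_pmf P"
      then have "0 < condm q I J x" for I J using that condm_pos by blast
      then show "log b (\<Prod>(I,J)\<in>F. condm q I J x) = (\<Sum>(I,J)\<in>F. log b (condm q I J x))"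
        using F by (simp add: log_def ln_prod less_imp_neq[symmetric] case_prod_unfold sum_divide_distrib)
    qed
    then show ?thesis by (simp add: case_prod_unfold int)
  qed
  have Pr: "set_pmf P \<subseteq> set_pmf r"
  proof
    fix x assume x: "x \<in> set_pmf P"
    have "0 < (\<Prod>(I,J)\<in>F. condm P I J x)"
      using condm_pos[OF x] by (auto intro!: prod_pos)
    then show "x \<in> set_pmf r" using r(2)[OF x] by (simp add: set_pmf_iff)
  qed
  have r_val: "(\<integral>x. log b (pmf r x) \<partial>measure_pmf P)
      = (\<Sum>(I,J)\<in>F. \<integral>x. log b (condm P I J x) \<partial>measure_pmf P)"
  proof (subst log_prod[of P, symmetric])
    show "(\<integral>x. log b (pmf r x) \<partial>measure_pmf P) = (\<integral>x. log b (\<Prod>(I,J)\<in>F. condm P I J x) \<partial>measure_pmf P)"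
      using r(2) by (intro integral_cong_AE) (auto simp: AE_measure_pmf_iff)
  qed simp
  have Lr: "0 < likelihood m s r" using Pr m by (simp add: likelihood_pos_iff P_def)
  have max: "likelihood m s q \<le> likelihood m s r" if q: "q \<in> C" for q
  proof (cases "0 < likelihood m s q")
    case True
    then have Pq: "set_pmf P \<subseteq> set_pmf q" using m by (simp add: likelihood_pos_iff P_def)
    have "(\<integral>x. log b (pmf q x) \<partial>measure_pmf P) = (\<integral>x. log b (\<Prod>(I,J)\<in>F. condm q I J x) \<partial>measure_pmf P)"
      using C(2)[OF q] V(2) by (intro integral_cong_AE) (auto simp: AE_measure_pmf_iff subset_iff)
    also have "\<dots> = (\<Sum>(I,J)\<in>F. \<integral>x. log b (condm q I J x) \<partial>measure_pmf P)"
      by (rule log_prod[OF Pq])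
    also have "\<dots> \<le> (\<Sum>(I,J)\<in>F. \<integral>x. log b (condm P I J x) \<partial>measure_pmf P)"
      using finite_subset[OF C(1)[OF q] V(1)] Pq b
      by (auto intro!: sum_mono conditional_gibbs_condm)
    also have "\<dots> = (\<integral>x. log b (pmf r x) \<partial>measure_pmf P)" using r_val by simp
    finally have "log b (likelihood m s q) \<le> log b (likelihood m s r)"
      using log_likelihood[OF b m, of s q] log_likelihood[OF b m, of s r] Pq Pr m
      unfolding P_def by (simp add: mult_left_mono)
    then show ?thesis using b True Lr by simp
  next
    case False then show ?thesis using Lr by linarith
  qed
  have Sup: "(SUP q\<in>C. likelihood m s q) = likelihood m s r"
    using max r(1) by (intro cSup_eq_maximum) auto
  show "0 < (SUP q\<in>C. likelihood m s q)" using Sup Lr by simp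
  show "log b (SUP q\<in>C. likelihood m s q)
       = real m * (\<Sum>(I,J)\<in>F. marg_entropy b P J - marg_entropy b P (I \<union> J))"
    using Sup log_likelihood[OF b m, of s r] Pr r_val integral_log_condm[OF b fP] unfolding P_def by simp
qed

section \<open>Construction of the maximisers by gluing\<close>

text \<open>
  Draw \<open>x\<close> from \<open>q\<close>, then \<open>y\<close> from \<open>q'\<close> conditioned on agreeing with \<open>x\<close> on \<open>K\<close>, and return \<open>x\<close>
  on \<open>I\<close> and \<open>y\<close> elsewhere. If the conditioning event is null, \<open>y = x\<close> is an arbitrary choice: the
  maximiser over \<open>K_H\<close> can give mass to values of \<open>X\<^sub>-\<^sub>j\<close> that never occur in the sample.
\<close>
definition glue :: "(nat \<Rightarrow> 'a) pmf \<Rightarrow> (nat \<Rightarrow> 'a) pmf \<Rightarrow> nat set \<Rightarrow> nat set \<Rightarrow> (nat \<Rightarrow> 'a) pmf" where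
  "glue q q' I K = bind_pmf q (\<lambda>x. map_pmf (\<lambda>y i. if i \<in> I then x i else y i)
     (if marg q' K x = 0 then return_pmf x else cond_pmf q' {y. \<forall>i\<in>K. y i = x i}))"

lemma marg_zero_iff: "marg q K x = 0 \<longleftrightarrow> set_pmf q \<inter> {y. \<forall>i\<in>K. y i = x i} = {}"
  by (simp add: marg_def measure_pmf_zero_iff)

lemma glue_in_dist_on:
  assumes "q \<in> dist_on n A" "q' \<in> dist_on n A"
  shows "glue q q' I K \<in> dist_on n A"
proof -
  have "(\<lambda>i. if i \<in> I then x i else y i) \<in> vectors n A"
    if "x \<in> vectors n A" "y \<in> vectors n A" for x y
    using that by (auto simp: vectors_def PiE_iff extensional_def)
  then show ?thesis
    using assms by (auto simp: dist_on_def glue_def marg_zero_iff split: if_splits) blast+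
qed

text \<open>Casting the event as a Boolean random variable lets marginals of \<open>glue\<close> be
  computed with the laws of \<open>map_pmf\<close> and \<open>bind_pmf\<close>.\<close>

lemma marg_conv_pmf_map: "marg q L z = pmf (map_pmf (\<lambda>w. \<forall>i\<in>L. w i = z i) q) True"
  by (simp add: marg_def pmf_map vimage_def)

lemma marg_glue_left:
  assumes "L \<subseteq> I"
  shows "marg (glue q q' I K) L z = marg q L z"
proof -
  have *: "(\<forall>i\<in>L. (if i \<in> I then x i else y i) = z i) \<longleftrightarrow> (\<forall>i\<in>L. x i = z i)" for x y
    using assms by (intro ball_cong) auto
  show ?thesis
    by (simp add: marg_conv_pmf_map glue_def map_bind_pmf pmf.map_comp o_def * map_pmf_def bind_assoc_pmf bind_return_pmf)
qed

text \<open>The result is read from \<open>x\<close> on \<open>L\<close> and from \<open>y\<close>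
  on \<open>L'\<close>. As \<open>K \<subseteq> L\<close>, agreement of \<open>x\<close> with
  \<open>z\<close> on \<open>L\<close> fixes the conditioning event, so the inner draw contributes
  the same constant for all such \<open>x\<close>.\<close>

lemma marg_glue:
  assumes L: "K \<subseteq> L" "L \<subseteq> I" "L' \<inter> I = {}" and pos: "marg q' K z \<noteq> 0"
  shows "marg (glue q q' I K) (L \<union> L') z = marg q L z * condm q' L' K z"
proof -
  let ?k = "\<lambda>x. if marg q' K x = 0 then return_pmf x else cond_pmf q' {y. \<forall>i\<in>K. y i = x i}"
  let ?f = "\<lambda>x y i. if i \<in> I then x i else y i"
  have inner: "pmf (map_pmf (\<lambda>w. \<forall>i\<in>L\<union>L'. w i = z i) (map_pmf (?f x) (?k x))) True
      = condm q' L' K z * indicator {x. \<forall>i\<in>L. x i = z i} x" for x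
  proof (cases "\<forall>i\<in>L. x i = z i")
    case False
    then have "(\<forall>i\<in>L\<union>L'. ?f x y i = z i) \<longleftrightarrow> False" for y using L by auto
    then show ?thesis using False
      by (simp only: pmf.map_comp o_def) simp
  next
    case True
    have *: "(\<forall>i\<in>L\<union>L'. ?f x y i = z i) \<longleftrightarrow> (\<forall>i\<in>L'. y i = z i)" for y
      using True L by auto
    have K: "{y. \<forall>i\<in>K. y i = x i} = {y. \<forall>i\<in>K. y i = z i}"
      using True L by auto
    then have k: "?k x = cond_pmf q' {y. \<forall>i\<in>K. y i = z i}"
      using pos by (simp add: marg_def)
    have ne: "set_pmf q' \<inter> {y. \<forall>i\<in>K. y i = z i} \<noteq> {}"
      using pos by (simp add: marg_zero_iff)
    have "measure (cond_pmf q' {y. \<forall>i\<in>K. y i = z i}) {y. \<forall>i\<in>L'. y i = z i}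
        = measure q' ({y. \<forall>i\<in>K. y i = z i} \<inter> {y. \<forall>i\<in>L'. y i = z i}) / measure q' {y. \<forall>i\<in>K. y i = z i}"
      unfolding cond_pmf.rep_eq[OF ne]
      by (intro measure_uniform_measure) (use emeasure_measure_pmf_not_zero[OF ne] in auto)
    also have "\<dots> = condm q' L' K z"
      by (auto simp: condm_def cond_prob_def intro!: arg_cong2[where f="(/)"] arg_cong2[where f=measure])
    finally show ?thesis unfolding k
      using True by (simp add: pmf.map_comp o_def pmf_map * vimage_def)
  qed
  have "marg (glue q q' I K) (L \<union> L') z
      = (\<integral>x. condm q' L' K z * indicator {x. \<forall>i\<in>L. x i = z i} x \<partial>measure_pmf q)"
    unfolding marg_conv_pmf_map[of "glue q q' I K"] unfolding glue_def map_bind_pmf pmf_bind inner ..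
  then show ?thesis by (simp add: marg_def)
qed

text \<open>Redrawing the coordinates after \<open>j\<close> given coordinate \<open>j\<close> alone
  makes the two blocks conditionally independent, while both keep their conditional laws under
  \<open>P\<close>.\<close>

lemma glue_in_K_T:
  fixes P :: "(nat \<Rightarrow> 'a) pmf"
  assumes P: "P \<in> dist_on n A" and j: "j \<in> {1..n}"
  defines "r \<equiv> glue P P {1..j} {j}"
  shows "r \<in> K_T n A j"
    and "x \<in> set_pmf P \<Longrightarrow>
      pmf r x = condm P {j} {} x * condm P {1..<j} {j} x * condm P {j<..n} {j} x"
proof -
  have r: "r \<in> dist_on n A" unfolding r_def by (intro glue_in_dist_on P)
  have sets: "{1..<j} \<union> {j} = {1..j}" "{j<..n} \<union> {j} = {j} \<union> {j<..n}" "{1..j} \<union> {j<..n} = {1..n}"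
    using j by auto
  have left: "marg r L x = marg P L x" if "L \<subseteq> {1..j}" for L x
    unfolding r_def using that by (rule marg_glue_left)
  \<comment> \<open>The choice \<open>L = {1..j}\<close> yields the point masses of
    \<open>r\<close>, and \<open>L = {j}\<close> the conditional law of its right block.\<close>
  have right: "marg r (L \<union> {j<..n}) x = marg P L x * condm P {j<..n} {j} x"
    if "marg P {j} x \<noteq> 0" "{j} \<subseteq> L" "L \<subseteq> {1..j}" for L x
    unfolding r_def using that by (intro marg_glue) auto
  have fact: "pmf r x = marg P {j} x * condm P {1..<j} {j} x * condm P {j<..n} {j} x"
    if "marg P {j} x \<noteq> 0" "x \<in> vectors n A" for x
    using right[of x "{1..j}"] that j marg_all[OF r] sets by (simp add: condm_eq)
  show "r \<in> K_T n A j" unfolding K_T_def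
  proof (safe intro!: r)
    fix x assume x: "x \<in> vectors n A"
    show "pmf r x = marg r {j} x * condm r {1..<j} {j} x * condm r {j<..n} {j} x"
    proof (cases "marg P {j} x = 0")
      \<comment> \<open>Both sides vanish: \<open>r\<close> gives no mass to this value of
        coordinate \<open>j\<close>.\<close>
      case True
      then have "marg r {j} x = 0" using left[of "{j}" x] j by simp
      moreover have "marg r {1..n} x \<le> marg r {j} x" using j by (intro marg_antimono) auto
      ultimately show ?thesis using marg_all[OF r x] marg_nonneg[of r "{1..n}" x] by simp
    next
      case False
      have "condm r {j<..n} {j} x = condm P {j<..n} {j} x"
        using right[OF False, of "{j}"] left[of "{j}" x] False j unfolding condm_eq[of r] sets(2) by simp
      moreover have "condm r {1..<j} {j} x = condm P {1..<j} {j} x"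
        using left j unfolding condm_eq sets by simp
      ultimately show ?thesis using fact[OF False x] left[of "{j}" x] j by simp
    qed
  qed
  show "pmf r x = condm P {j} {} x * condm P {1..<j} {j} x * condm P {j<..n} {j} x" if x: "x \<in> set_pmf P"
    using fact[of x] marg_pos[OF x, of "{j}"] x P by (auto simp: dist_on_def condm_eq)
qed

text \<open>The inner gluing, conditioned on nothing, makes the two blocks independent with their
  marginals under \<open>P\<close>. The outer one then redraws coordinate \<open>j\<close> alone,
  from its conditional law under \<open>P\<close> given all the others.\<close>

lemma glue_in_K_H:
  fixes P :: "(nat \<Rightarrow> 'a) pmf"
  assumes P: "P \<in> dist_on n A" and j: "j \<in> {1..n}"
  defines "r \<equiv> glue (glue P P {1..<j} {}) P (- {j}) ({1..n} - {j})"
  shows "r \<in> K_H n A j"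
    and "x \<in> set_pmf P \<Longrightarrow>
      pmf r x = condm P {j} ({1..n} - {j}) x * condm P {1..<j} {} x * condm P {j<..n} {} x"
proof -
  let ?c = "{1..n} - {j}"
  have r: "r \<in> dist_on n A" unfolding r_def by (intro glue_in_dist_on P)
  have sets: "{1..<j} \<union> {j<..n} = ?c" "{j} \<union> ?c = {1..n}" "?c \<union> {j} = {1..n}"
    using j by auto
  have indep: "marg (glue P P {1..<j} {}) (L \<union> {j<..n}) x = marg P L x * marg P {j<..n} x"
    if "L \<subseteq> {1..<j}" for L x
    using that by (subst marg_glue) (auto simp: condm_eq)
  have left: "marg r L x = marg (glue P P {1..<j} {}) L x" if "j \<notin> L" for L x
    unfolding r_def using that by (intro marg_glue_left) auto
  \<comment> \<open>In \<open>indep\<close>, \<open>L = {}\<close> gives the right block and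
    \<open>L = {1..<j}\<close> the two blocks jointly.\<close>
  have m: "marg r {1..<j} x = marg P {1..<j} x" "marg r {j<..n} x = marg P {j<..n} x"
    "marg r ?c x = marg P {1..<j} x * marg P {j<..n} x" for x
    using indep[of "{}" x] indep[of "{1..<j}" x] unfolding sets by (simp_all add: left marg_glue_left)
  show "r \<in> K_H n A j" unfolding K_H_def
  proof (safe intro!: r)
    fix x assume x: "x \<in> vectors n A"
    \<comment> \<open>Membership only constrains the law of the two blocks: the conditional factor
      is that of \<open>r\<close> itself, and where its conditioning event is null both sides are
      0.\<close>
    have "marg r {1..n} x \<le> marg r ?c x" using j by (intro marg_antimono) auto
    moreover have "condm r {j} ?c x = marg r {1..n} x / marg r ?c x"
      unfolding condm_eq sets ..
    ultimately have "pmf r x = condm r {j} ?c x * marg r ?c x"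
      using marg_all[OF r x] marg_nonneg[of r "{1..n}" x] by (cases "marg r ?c x = 0") auto
    then show "pmf r x = condm r {j} ?c x * marg r {1..<j} x * marg r {j<..n} x"
      using m[of x] by simp
  qed
  show "pmf r x = condm P {j} ?c x * condm P {1..<j} {} x * condm P {j<..n} {} x" if x: "x \<in> set_pmf P"
  proof -
    have "x \<in> vectors n A" using x P by (auto simp: dist_on_def)
    then have "pmf r x = marg r (?c \<union> {j}) x" using marg_all[OF r] sets by simp
    also have "\<dots> = marg (glue P P {1..<j} {}) ?c x * condm P {j} ?c x"
      unfolding r_def using marg_pos[OF x, of ?c] by (intro marg_glue) auto
    also have "\<dots> = condm P {j} ?c x * condm P {1..<j} {} x * condm P {j<..n} {} x"
      using m(3)[of x] left[of ?c x] by (simp add: condm_eq)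
    finally show ?thesis .
  qed
qed

section \<open>The sum of log-likelihood ratios as an O-information\<close>

text \<open>As a functional of the distribution it can be evaluated both at \<open>p\<close> and at
  the empirical distribution.\<close>

definition pmf_O_information :: "real \<Rightarrow> nat \<Rightarrow> (nat \<Rightarrow> 'a) pmf \<Rightarrow> real" where
  "pmf_O_information b n q = (real n - 2) * marg_entropy b q {1..n}
     + (\<Sum>j=1..n. marg_entropy b q {j} - marg_entropy b q ({1..n} - {j}))"

text \<open>Per sample, the maximal log-likelihood is \<open>h {j} - h {1..j} - h {j..n}\<close>
  over \<open>K_T\<close> and \<open>h ({1..n} - {j}) - h {1..n} - h {1..<j} - h {j<..n}\<close>
  over \<open>K_H\<close>. The difference is grouped so that the last two brackets telescope in
  \<open>j\<close>.\<close>

lemma gen_llr_eq: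
  fixes s :: "nat \<Rightarrow> nat \<Rightarrow> 'a"
  assumes b: "1 < b" and m: "1 \<le> m" and A: "\<And>i. i \<in> {1..n} \<Longrightarrow> finite (A i)"
    and s: "\<And>k. k \<in> {1..m} \<Longrightarrow> s k \<in> vectors n A" and j: "j \<in> {2..n - 1}"
  defines "h \<equiv> marg_entropy b (empirical m s)"
  shows "gen_llr b (K_T n A j) (K_H n A j) m s
     = real m * (h {1..n} - h ({1..n} - {j}) + h {j}
         + (h {1..<j} - h {1..j}) + (h {j<..n} - h {j..n}))"
proof -
  let ?P = "empirical m s" and ?V = "vectors n A"
  have jn: "j \<in> {1..n}" using j by auto
  have P: "set_pmf ?P \<subseteq> ?V" using m s by (auto simp: set_empirical)
  then have P': "?P \<in> dist_on n A" by (simp add: dist_on_def)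
  have V: "finite ?V" by (rule finite_vectors[OF A])
  \<comment> \<open>For \<open>j\<close> strictly between 1 and \<open>n\<close> both blocks are
    nonempty, so the three index pairs are distinct and a product over the set of pairs really has
    three factors.\<close>
  have ne: "1 \<in> {1..<j}" "n \<in> {j<..n}" "1 \<notin> {j<..n}" "1 \<notin> {j}" "n \<notin> {j}" using j by auto
  let ?FT = "{({j},{}), ({1..<j},{j}), ({j<..n},{j})} :: (nat set \<times> nat set) set"
  let ?FH = "{({j},{1..n}-{j}), ({1..<j},{}), ({j<..n},{})} :: (nat set \<times> nat set) set"
  have dist: "({j},{}) \<notin> {({1..<j},{j}), ({j<..n},{j})}" "({1..<j},{j}) \<noteq> ({j<..n},{j})"
    "({j},{1..n}-{j}) \<notin> {({1..<j},{}), ({j<..n},{})}" "({1..<j},{}) \<noteq> ({j<..n},{})"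
    using ne by blast+
  have prodT: "(\<Prod>(I,J)\<in>?FT. f I J) = f {j} {} * f {1..<j} {j} * f {j<..n} {j}" 
    and sumT: "(\<Sum>(I,J)\<in>?FT. f I J) = f {j} {} + f {1..<j} {j} + f {j<..n} {j}"
    and prodH: "(\<Prod>(I,J)\<in>?FH. f I J) = f {j} ({1..n}-{j}) * f {1..<j} {} * f {j<..n} {}" 
    and sumH: "(\<Sum>(I,J)\<in>?FH. f I J) = f {j} ({1..n}-{j}) + f {1..<j} {} + f {j<..n} {}"
    for f :: "nat set \<Rightarrow> nat set \<Rightarrow> real"
    using dist by (simp_all add: mult.assoc add.assoc)
  note max_T = log_Sup_likelihood[OF b m V P, of ?FT "K_T n A j" "glue ?P ?P {1..j} {j}",
      folded h_def, unfolded prodT]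
  have T: "0 < (SUP q\<in>K_T n A j. likelihood m s q)"
    "log b (SUP q\<in>K_T n A j. likelihood m s q) = real m * (\<Sum>(I,J)\<in>?FT. h J - h (I \<union> J))"
    by (rule max_T; use glue_in_K_T[OF P' jn] in \<open>simp add: K_T_def dist_on_def\<close>)+
  note max_H = log_Sup_likelihood[OF b m V P, of ?FH "K_H n A j"
      "glue (glue ?P ?P {1..<j} {}) ?P (- {j}) ({1..n} - {j})", folded h_def, unfolded prodH]
  have H: "0 < (SUP q\<in>K_H n A j. likelihood m s q)"
    "log b (SUP q\<in>K_H n A j. likelihood m s q) = real m * (\<Sum>(I,J)\<in>?FH. h J - h (I \<union> J))"
    by (rule max_H; use glue_in_K_H[OF P' jn] in \<open>simp add: K_H_def dist_on_def\<close>)+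
  have sets: "{1..<j} \<union> {j} = {1..j}" "{j<..n} \<union> {j} = {j..n}" "{j} \<union> ({1..n} - {j}) = {1..n}"
    using jn by auto
  have h0: "h {} = 0" by (simp add: h_def)
  have "gen_llr b (K_T n A j) (K_H n A j) m s
      = log b (SUP q\<in>K_T n A j. likelihood m s q) - log b (SUP q\<in>K_H n A j. likelihood m s q)"
    unfolding gen_llr_def using T(1) H(1) b by (simp add: log_divide_pos)
  also have "\<dots> = real m * (h {1..n} - h ({1..n} - {j}) + h {j}
         + (h {1..<j} - h {1..j}) + (h {j<..n} - h {j..n}))"
    unfolding T(2) H(2) sumT sumH sets Un_empty_right h0 by (simp add: algebra_simps)
  finally show ?thesis .
qed

text \<open>An exact identity for every sample. The prefix and suffix entropies telescope, and the
  range \<open>2..n-1\<close> has \<open>n - 2\<close> elements, which gives the coefficient of the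
  joint entropy.\<close>

lemma sum_gen_llr_eq:
  fixes s :: "nat \<Rightarrow> nat \<Rightarrow> 'a"
  assumes b: "1 < b" and m: "1 \<le> m" and n: "2 \<le> n" and A: "\<And>i. i \<in> {1..n} \<Longrightarrow> finite (A i)"
    and s: "\<And>k. k \<in> {1..m} \<Longrightarrow> s k \<in> vectors n A"
  shows "1 / real m * (\<Sum>j=2..n-1. gen_llr b (K_T n A j) (K_H n A j) m s)
     = pmf_O_information b n (empirical m s)"
proof -
  define h where "h = marg_entropy b (empirical m s)"
  let ?d = "\<lambda>j. h {j} - h ({1..n} - {j})"
  have "(\<Sum>j=2..n-1. gen_llr b (K_T n A j) (K_H n A j) m s)
      = real m * (\<Sum>j=2..n-1. h {1..n} + ?d j + (h {1..<j} - h {1..j}) + (h {j<..n} - h {j..n}))"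
    unfolding sum_distrib_left
    using gen_llr_eq[OF b m A s] by (intro sum.cong refl) (simp add: h_def algebra_simps)
  then have "1 / real m * (\<Sum>j=2..n-1. gen_llr b (K_T n A j) (K_H n A j) m s)
      = (\<Sum>j=2..n-1. h {1..n} + ?d j + (h {1..<j} - h {1..j}) + (h {j<..n} - h {j..n}))"
    using m by simp
  also have "\<dots> = (real n - 2) * h {1..n} + (\<Sum>j=2..n-1. ?d j)
      + (\<Sum>j=2..n-1. h {1..<j} - h {1..j}) + (\<Sum>j=2..n-1. h {j<..n} - h {j..n})"
    using n by (simp add: sum.distrib of_nat_diff)
  also have "(\<Sum>j=2..n-1. h {1..<j} - h {1..j}) = h {1} - h {1..n-1}"
  proof -
    have "(\<Sum>j=2..n-1. h {1..<j} - h {1..j}) = (\<Sum>j=1..<n-1. - (h {1..Suc j} - h {1..j}))"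
      using n by (intro sum.reindex_bij_witness[of _ Suc "\<lambda>j. j - 1"])
        (auto simp: atLeastLessThanSuc_atLeastAtMost intro!: arg_cong[where f=h])
    also have "\<dots> = - (h {1..n-1} - h {1..1})"
      unfolding sum_negf using n by (subst sum_Suc_diff') auto
    finally show ?thesis by simp
  qed
  also have "(\<Sum>j=2..n-1. h {j<..n} - h {j..n}) = (\<Sum>j=2..<n. h {Suc j..n} - h {j..n})"
    using n by (intro sum.cong) (auto simp: atLeastSucAtMost_greaterThanAtMost)
  also have "\<dots> = h {n} - h {2..n}"
    using n by (subst sum_Suc_diff') auto
  \<comment> \<open>The telescoped ends pair crosswise: \<open>h {1} - h {2..n}\<close> is the
    missing term for index 1, and \<open>h {n} - h {1..n-1}\<close> the one for index
    \<open>n\<close>.\<close>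
  also have "(real n - 2) * h {1..n} + (\<Sum>j=2..n-1. ?d j) + (h {1} - h {1..n-1}) + (h {n} - h {2..n})
      = (real n - 2) * h {1..n} + (\<Sum>j=1..n. ?d j)"
  proof -
    have "{1..n} = insert 1 (insert n {2..n-1})" using n by auto
    then have "(\<Sum>j=1..n. ?d j) = ?d 1 + (?d n + (\<Sum>j=2..n-1. ?d j))"
      using n by (simp del: One_nat_def)
    moreover have "{1..n} - {1} = {2..n}" "{1..n} - {n} = {1..n-1}" using n by auto
    ultimately show ?thesis by simp
  qed
  finally show ?thesis by (simp add: pmf_O_information_def h_def)
qed

section \<open>From entropies of random variables to entropies of distributions\<close>

lemma measurable_count_space_UNIV_target:
  assumes "f \<in> M \<rightarrow>\<^sub>M count_space V"
  shows "f \<in> M \<rightarrow>\<^sub>M count_space UNIV"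
proof (rule measurableI)
  fix B
  have "f -` B \<inter> space M = f -` (B \<inter> V) \<inter> space M"
    using measurable_space[OF assms] by auto
  also have "\<dots> \<in> sets M" by (rule measurable_sets[OF assms]) simp
  finally show "f -` B \<inter> space M \<in> sets M" .
qed simp

text \<open>The map \<open>u\<close> will be the identity, a coordinate or a restriction. Finiteness
  of \<open>V\<close> makes the composite a simple function, whose entropy is a finite sum.\<close>

lemma shannon_eq:
  fixes X :: "'v \<Rightarrow> 'c" and u :: "'c \<Rightarrow> 'd"
  assumes b: "1 < b" and N: "prob_space N" and V: "finite V"
    and X: "X \<in> N \<rightarrow>\<^sub>M count_space V" and p: "distr N (count_space UNIV) X = measure_pmf p"
  shows "shannon b N (\<lambda>\<omega>. u (X \<omega>)) = - (\<integral>x. log b (measure p {y. u y = u x}) \<partial>measure_pmf p)"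
proof -
  interpret prob_space N by fact
  interpret information_space N b by standard (rule b)
  have X': "X \<in> N \<rightarrow>\<^sub>M count_space UNIV"
    by (rule measurable_count_space_UNIV_target[OF X])
  have prob: "measure N (X -` B \<inter> space N) = measure p B" for B
    using measure_distr[OF X', of B] p by simp
  have sp: "X \<omega> \<in> V" if "\<omega> \<in> space N" for \<omega>
    using measurable_space[OF X that] by simp
  have supp: "set_pmf p \<subseteq> X ` space N"
  proof
    fix x assume "x \<in> set_pmf p"
    then have "measure N (X -` {x} \<inter> space N) \<noteq> 0"
      by (simp add: prob measure_pmf_single set_pmf_iff)
    then have "X -` {x} \<inter> space N \<noteq> {}" by (metis measure_empty)
    then show "x \<in> X ` space N" by auto
  qed
  have fin: "finite (X ` space N)" using sp by (intro finite_subset[OF _ V]) auto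
  have "simple_function N (\<lambda>\<omega>. u (X \<omega>))"
  proof (unfold simple_function_def, safe)
    show "finite ((\<lambda>\<omega>. u (X \<omega>)) ` space N)" using finite_imageI[OF fin, of u] by (simp add: image_image)
    fix \<omega> assume "\<omega> \<in> space N"
    have "(\<lambda>\<omega>. u (X \<omega>)) -` {u (X \<omega>)} \<inter> space N = X -` (u -` {u (X \<omega>)}) \<inter> space N" by auto
    then show "(\<lambda>\<omega>. u (X \<omega>)) -` {u (X \<omega>)} \<inter> space N \<in> sets N"
      using measurable_sets[OF X'] by simp
  qed
  then have "simple_distributed N (\<lambda>\<omega>. u (X \<omega>)) (pmf (map_pmf u p))"
    by (rule simple_distributedI) (auto simp: pmf_map prob[symmetric] intro!: arg_cong[where f=prob])
  from entropy_simple_distributed[OF this]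
  have "shannon b N (\<lambda>\<omega>. u (X \<omega>))
      = - (\<Sum>w\<in>(\<lambda>\<omega>. u (X \<omega>)) ` space N. pmf (map_pmf u p) w * log b (pmf (map_pmf u p) w))"
    by (simp add: shannon_def)
  \<comment> \<open>The sum runs over all attained values, which include the support; attained
    values of probability 0 contribute 0.\<close>
  also have "\<dots> = - (\<integral>w. log b (pmf (map_pmf u p) w) \<partial>measure_pmf (map_pmf u p))"
    using supp fin by (subst integral_measure_pmf_real[of "(\<lambda>\<omega>. u (X \<omega>)) ` space N"])
      (auto simp: mult.commute image_image[of u X, symmetric] simp del: integral_map_pmf)
  also have "\<dots> = - (\<integral>x. log b (measure p {y. u y = u x}) \<partial>measure_pmf p)"
    by (simp add: pmf_map vimage_def)
  finally show ?thesis .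
qed

lemma distr_in_dist_on:
  assumes "prob_space N" and X: "X \<in> N \<rightarrow>\<^sub>M count_space (vectors n A)"
    and p: "distr N (count_space UNIV) X = measure_pmf p"
  shows "p \<in> dist_on n A"
proof -
  interpret prob_space N by fact
  have X': "X \<in> N \<rightarrow>\<^sub>M count_space UNIV"
    by (rule measurable_count_space_UNIV_target[OF X])
  have "X -` vectors n A \<inter> space N = space N" using measurable_space[OF X] by auto
  then have "measure p (vectors n A) = 1"
    using measure_distr[OF X', of "vectors n A"] p prob_space by simp
  then have "AE x in p. x \<in> vectors n A" using measure_pmf.AE_prob_1 by blast
  then show ?thesis by (auto simp: dist_on_def AE_measure_pmf_iff)
qed

lemma O_information_eq:
  assumes b: "1 < b" and A: "\<And>i. i \<in> {1..n} \<Longrightarrow> finite (A i)" and N: "prob_space N"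
    and X: "X \<in> N \<rightarrow>\<^sub>M count_space (vectors n A)"
    and p: "distr N (count_space UNIV) X = measure_pmf p"
  shows "O_information b n N X = pmf_O_information b n p"
proof -
  have P: "p \<in> dist_on n A" by (rule distr_in_dist_on[OF N X p])
  note H = shannon_eq[OF b N finite_vectors[OF A] X p]
  have "shannon b N X = marg_entropy b p {1..n}"
  proof -
    have "marg p {1..n} x = pmf p x" if "x \<in> set_pmf p" for x
      using that P by (intro marg_all[OF P]) (auto simp: dist_on_def)
    then have "marg_entropy b p {1..n} = - (\<integral>x. log b (pmf p x) \<partial>measure_pmf p)"
      unfolding marg_entropy_def by (auto intro!: integral_cong_AE simp: AE_measure_pmf_iff)
    then show ?thesis using H[of "\<lambda>x. x"] by (simp add: measure_pmf_single)
  qed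
  moreover have "shannon b N (\<lambda>\<omega>. X \<omega> j) = marg_entropy b p {j}" for j
    using H[of "\<lambda>x. x j"] by (simp add: marg_entropy_def marg_def)
  moreover have "shannon b N (\<lambda>\<omega>. restrict (X \<omega>) I) = marg_entropy b p I" for I
    using H[of "\<lambda>x. restrict x I"] by (simp add: marg_entropy_def marg_eq_pmf_map pmf_map vimage_def)
  ultimately show ?thesis by (simp add: O_information_def pmf_O_information_def)
qed

section \<open>Continuity of the O-information in the point masses\<close>

text \<open>The value 0 at the origin is the limit of x ln x from the right, so continuity survives
  at distributions with null points.\<close>

lemma continuous_on_x_log_x: "continuous_on {0..} (\<lambda>x::real. x * log b x)"
proof -
  have "((\<lambda>x::real. x * ln x) \<longlongrightarrow> 0) (at_right 0)" by real_asymp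
  moreover have "(at 0 within {0..}) = at_right (0::real)"
    by (rule at_within_Ici_at_right)
  ultimately have zero: "continuous (at 0 within {0..}) (\<lambda>x::real. x * ln x)"
    by (simp add: continuous_within)
  have pos: "continuous (at x within {0..}) (\<lambda>x::real. x * ln x)" if "x > 0" for x
    using that by (intro continuous_intros) auto
  have "continuous_on {0..} (\<lambda>x::real. x * ln x)"
    unfolding continuous_on_eq_continuous_within
  proof
    fix x :: real assume "x \<in> {0..}"
    then have "x = 0 \<or> x > 0" by auto
    then show "continuous (at x within {0..}) (\<lambda>x::real. x * ln x)"
      using zero pos by blast
  qed
  then have "continuous_on {0..} (\<lambda>x::real. x * ln x / ln b)"
    by (simp add: divide_inverse continuous_on_mult_right)
  then show ?thesis by (simp add: log_def)
qed

text \<open>In the integral both measure and integrand move with \<open>q\<close>. For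
  \<open>q\<close> supported in \<open>V\<close> it is a sum over the fixed finite set of
  restrictions, each term being x log x at a finite sum of point masses.\<close>

lemma tendsto_marg_entropy:
  assumes V: "finite V" and p: "set_pmf p \<subseteq> V"
    and F: "eventually (\<lambda>q. set_pmf q \<subseteq> V) F" and lim: "\<And>x. x \<in> V \<Longrightarrow> ((\<lambda>q. pmf q x) \<longlongrightarrow> pmf p x) F"
  shows "((\<lambda>q. marg_entropy b q I) \<longlongrightarrow> marg_entropy b p I) F"
proof -
  let ?u = "\<lambda>x. restrict x I"
  let ?m = "\<lambda>q w. \<Sum>x | x \<in> V \<and> ?u x = w. pmf q x"
  have eq: "marg_entropy b q I = - (\<Sum>w\<in>?u ` V. ?m q w * log b (?m q w))" if q: "set_pmf q \<subseteq> V" for q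
  proof -
    have m: "pmf (map_pmf ?u q) w = ?m q w" for w
    proof -
      have "measure q (?u -` {w}) = measure q {x \<in> V. ?u x = w}"
        using q by (intro measure_prob_cong_0) (auto simp: set_pmf_eq)
      then show ?thesis using V by (simp add: pmf_map measure_measure_pmf_finite)
    qed
    have "marg_entropy b q I = - (\<integral>w. log b (pmf (map_pmf ?u q) w) \<partial>measure_pmf (map_pmf ?u q))"
      by (simp add: marg_entropy_def marg_eq_pmf_map)
    also have "\<dots> = - (\<Sum>w\<in>?u ` V. log b (pmf (map_pmf ?u q) w) * pmf (map_pmf ?u q) w)"
      using q V by (subst integral_measure_pmf_real[of "?u ` V"]) (auto simp del: integral_map_pmf)
    finally show ?thesis by (simp add: m mult.commute)
  qed
  have "((\<lambda>q. - (\<Sum>w\<in>?u ` V. ?m q w * log b (?m q w))) \<longlongrightarrow> - (\<Sum>w\<in>?u ` V. ?m p w * log b (?m p w))) F"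
    by (intro tendsto_minus tendsto_sum continuous_on_tendsto_compose[OF continuous_on_x_log_x] lim)
      (auto intro!: sum_nonneg always_eventually)
  then have "((\<lambda>q. - (\<Sum>w\<in>?u ` V. ?m q w * log b (?m q w))) \<longlongrightarrow> marg_entropy b p I) F"
    by (simp add: eq[OF p])
  moreover have "\<forall>\<^sub>F q in F. marg_entropy b q I = - (\<Sum>w\<in>?u ` V. ?m q w * log b (?m q w))"
    using F by eventually_elim (rule eq)
  ultimately show ?thesis by (simp cong: tendsto_cong)
qed

lemma pmf_O_information_continuous:
  assumes V: "finite V" and p: "set_pmf p \<subseteq> V" and e: "0 < (\<epsilon>::real)"
  obtains \<delta> where "0 < \<delta>"
    "\<And>q. set_pmf q \<subseteq> V \<Longrightarrow> (\<And>x. x \<in> V \<Longrightarrow> \<bar>pmf q x - pmf p x\<bar> < \<delta>)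
       \<Longrightarrow> \<bar>pmf_O_information b n q - pmf_O_information b n p\<bar> < \<epsilon>"
proof -
  let ?N = "\<lambda>\<delta>. {q. set_pmf q \<subseteq> V \<and> (\<forall>x\<in>V. \<bar>pmf q x - pmf p x\<bar> < \<delta>)}"
  \<comment> \<open>The neighbourhoods of \<open>p\<close>, in the maximum distance of point masses,
    among distributions supported in \<open>V\<close>. As a filter they make the limit rules
    available; unfolding it at the end returns the required \<open>\<delta>\<close>.\<close>
  define F where "F = (\<Sqinter>\<delta>\<in>{0<..}. principal (?N \<delta>))"
  have F: "eventually Q F \<longleftrightarrow> (\<exists>\<delta>>0. \<forall>q\<in>?N \<delta>. Q q)" for Q
    unfolding F_def
  proof (subst eventually_INF_base)
    fix a c :: real assume "a \<in> {0<..}" "c \<in> {0<..}"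
    then show "\<exists>x\<in>{0<..}. principal (?N x) \<le> inf (principal (?N a)) (principal (?N c))"
      by (intro bexI[of _ "min a c"]) auto
  qed (auto simp: eventually_principal)
  have supp: "eventually (\<lambda>q. set_pmf q \<subseteq> V) F"
    unfolding F by (intro exI[of _ 1]) auto
  have lim: "((\<lambda>q. pmf q x) \<longlongrightarrow> pmf p x) F" if "x \<in> V" for x
    unfolding tendsto_iff dist_real_def F using that by blast
  have "((\<lambda>q. pmf_O_information b n q) \<longlongrightarrow> pmf_O_information b n p) F"
    unfolding pmf_O_information_def
    by (intro tendsto_intros tendsto_marg_entropy[OF V p supp lim])
  then have "eventually (\<lambda>q. \<bar>pmf_O_information b n q - pmf_O_information b n p\<bar> < \<epsilon>) F"
    using e by (auto simp: tendsto_iff dist_real_def)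
  then show ?thesis using that unfolding F by blast
qed

section \<open>Concentration of the empirical frequencies\<close>

text \<open>The frequency of \<open>x\<close> is the mean of \<open>m\<close> i.i.d. indicators with
  expectation \<open>pmf p x\<close>, so Hoeffding's two-sided inequality applies. Measurability of
  the event is recorded for the union bound.\<close>

lemma empirical_concentration:
  assumes M: "prob_space M" and m: "1 \<le> m" and d: "0 < \<delta>"
    and indep: "prob_space.indep_vars M (\<lambda>_. count_space V) S {1..m}"
    and distr: "\<And>k. k \<in> {1..m} \<Longrightarrow> distr M (count_space UNIV) (S k) = measure_pmf p"
  shows "\<P>(\<omega> in M. \<bar>pmf (empirical m (\<lambda>k. S k \<omega>)) x - pmf p x\<bar> \<ge> \<delta>) \<le> 2 * exp (- 2 * real m * \<delta>\<^sup>2)"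
    and "{\<omega> \<in> space M. \<bar>pmf (empirical m (\<lambda>k. S k \<omega>)) x - pmf p x\<bar> \<ge> \<delta>} \<in> sets M"
proof -
  interpret prob_space M by fact
  let ?Y = "\<lambda>k \<omega>. indicator {x} (S k \<omega>) :: real"
  have S: "S k \<in> M \<rightarrow>\<^sub>M count_space UNIV" if "k \<in> {1..m}" for k
  proof -
    have "S k \<in> M \<rightarrow>\<^sub>M count_space V" using indep that by (simp add: indep_vars_def2)
    then show ?thesis by (rule measurable_count_space_UNIV_target)
  qed
  have distr_Y: "distr M borel (?Y k) = distr p borel (indicator {x})" if "k \<in> {1..m}" for k
  proof -
    have "distr M borel (?Y k) = distr (distr M (count_space UNIV) (S k)) borel (indicator {x})"
      using S[OF that] by (subst distr_distr) (auto simp: o_def)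
    then show ?thesis using distr[OF that] by simp
  qed
  have one: "1 \<in> {1..m}" using m by simp
  interpret Y: Hoeffding_ineq_iid M "{1..m}" ?Y "?Y 1" 0 1 "expectation (?Y 1)"
  proof unfold_locales
    show "indep_vars (\<lambda>_. borel) ?Y {1..m}"
      by (rule indep_vars_compose2[OF indep]) simp
    show "random_variable borel (?Y 1)"
      using S[OF one] by (rule measurable_compose) simp
    show "distr M borel (?Y k) = distr M borel (?Y 1)" if "k \<in> {1..m}" for k
      using distr_Y[OF that] distr_Y[OF one] by simp
  qed (auto simp: indicator_def)
  have "expectation (?Y 1) = (\<integral>y. indicator {x} y \<partial>distr M (count_space UNIV) (S 1))"
    using S[OF one] by (subst integral_distr) auto
  then have mu: "expectation (?Y 1) = pmf p x"
    using distr[OF one] by (simp add: measure_pmf_single)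
  \<comment> \<open>Reading the indicator as a point mass of \<open>return_pmf\<close> turns the
    empirical frequency into a bind over a uniform draw, that is, an average.\<close>
  have ret: "pmf (return_pmf y) x = indicator {x} y" for y
    by (simp add: indicator_def)
  have emp: "pmf (empirical m (\<lambda>k. S k \<omega>)) x = (\<Sum>k\<in>{1..m}. ?Y k \<omega>) / real (card {1..m})" for \<omega>
    unfolding empirical_def map_pmf_def ret[symmetric]
    by (rule pmf_bind_pmf_of_set) (use one in auto)
  show "\<P>(\<omega> in M. \<bar>pmf (empirical m (\<lambda>k. S k \<omega>)) x - pmf p x\<bar> \<ge> \<delta>) \<le> 2 * exp (- 2 * real m * \<delta>\<^sup>2)"
    using Y.Hoeffding_ineq_abs_ge'[of \<delta>] d m unfolding emp mu by simp
  have [measurable]: "?Y k \<in> borel_measurable M" if "k \<in> {1..m}" for k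
    using S[OF that] by (rule measurable_compose) simp
  show "{\<omega> \<in> space M. \<bar>pmf (empirical m (\<lambda>k. S k \<omega>)) x - pmf p x\<bar> \<ge> \<delta>} \<in> sets M"
    unfolding emp by measurable
qed

section \<open>Convergence in probability\<close>

theorem proposition3:
  fixes b :: real
    and n :: nat
    and A :: "nat \<Rightarrow> 'a set"
    and p :: "(nat \<Rightarrow> 'a) pmf"
    and N :: "'v measure" and X :: "'v \<Rightarrow> nat \<Rightarrow> 'a"
    and M :: "nat \<Rightarrow> 'w measure" and S :: "nat \<Rightarrow> nat \<Rightarrow> 'w \<Rightarrow> nat \<Rightarrow> 'a"
  assumes "1 < b" and "2 \<le> n"
    and "\<And>i. i \<in> {1..n} \<Longrightarrow> finite (A i)"
    and "prob_space N"
    and "X \<in> N \<rightarrow>\<^sub>M count_space (vectors n A)"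
    and "distr N (count_space UNIV) X = measure_pmf p"
    and "\<And>m. 1 \<le> m \<Longrightarrow> prob_space (M m)"
    and "\<And>m. 1 \<le> m \<Longrightarrow>
           prob_space.indep_vars (M m) (\<lambda>_. count_space (vectors n A)) (S m) {1..m}"
    and "\<And>m k. 1 \<le> m \<Longrightarrow> k \<in> {1..m} \<Longrightarrow>
           distr (M m) (count_space UNIV) (S m k) = measure_pmf p"
  shows "converges_in_prob M
           (\<lambda>m \<omega>. 1 / real m *
              (\<Sum>j=2..n-1. gen_llr b (K_T n A j) (K_H n A j) m (\<lambda>k. S m k \<omega>)))
           (O_information b n N X)"
proof -
  have "O_information b n N X = pmf_O_information b n p"
    using assms(1,3-6) by (rule O_information_eq)
  then show ?thesis unfolding converges_in_prob_def
  proof (simp only:, intro allI impI)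
   fix \<epsilon> :: real assume e: "0 < \<epsilon>"
    let ?V = "vectors n A"
    let ?Y = "\<lambda>m \<omega>. 1 / real m * (\<Sum>j=2..n-1. gen_llr b (K_T n A j) (K_H n A j) m (\<lambda>k. S m k \<omega>))"
    have V: "finite ?V" by (rule finite_vectors[OF assms(3)])
    have p: "set_pmf p \<subseteq> ?V" using distr_in_dist_on[OF assms(4-6)] by (simp add: dist_on_def)
    obtain \<delta> where d: "0 < \<delta>" and cont:
      "\<And>q. set_pmf q \<subseteq> ?V \<Longrightarrow> (\<And>x. x \<in> ?V \<Longrightarrow> \<bar>pmf q x - pmf p x\<bar> < \<delta>)
         \<Longrightarrow> \<bar>pmf_O_information b n q - pmf_O_information b n p\<bar> < \<epsilon>"
      using pmf_O_information_continuous[OF V p e] by metis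
    have bound: "\<P>(\<omega> in M m. \<bar>?Y m \<omega> - pmf_O_information b n p\<bar> > \<epsilon>)
        \<le> real (card ?V) * (2 * exp (- 2 * real m * \<delta>\<^sup>2))" if m: "1 \<le> m" for m
    proof -
      interpret prob_space "M m" using assms(7) m .
      let ?D = "\<lambda>x. {\<omega> \<in> space (M m). \<bar>pmf (empirical m (\<lambda>k. S m k \<omega>)) x - pmf p x\<bar> \<ge> \<delta>}"
      note conc = empirical_concentration[OF assms(7)[OF m] m d assms(8)[OF m] assms(9)[OF m]]
      \<comment> \<open>If every frequency is within \<open>\<delta>\<close> of its limit, the
        statistic, being the O-information of the empirical distribution, is within
        \<open>\<epsilon>\<close>. The union bound over \<open>?V\<close> needs measurability of the
        covering events only.\<close>
      have "{\<omega> \<in> space (M m). \<bar>?Y m \<omega> - pmf_O_information b n p\<bar> > \<epsilon>} \<subseteq> (\<Union>x\<in>?V. ?D x)"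
      proof (safe, rule ccontr)
        fix \<omega> assume \<omega>: "\<omega> \<in> space (M m)" and gt: "\<epsilon> < \<bar>?Y m \<omega> - pmf_O_information b n p\<bar>"
          and "\<omega> \<notin> (\<Union>x\<in>?V. ?D x)"
        then have close: "\<bar>pmf (empirical m (\<lambda>k. S m k \<omega>)) x - pmf p x\<bar> < \<delta>" if "x \<in> ?V" for x
          using that by force
        have sV: "S m k \<omega> \<in> ?V" if "k \<in> {1..m}" for k
          using assms(8)[OF m] that measurable_space[OF _ \<omega>, of "S m k" "count_space ?V"]
          by (simp add: indep_vars_def2)
        have "?Y m \<omega> = pmf_O_information b n (empirical m (\<lambda>k. S m k \<omega>))"
          by (rule sum_gen_llr_eq[OF assms(1) m assms(2,3) sV])
        moreover have "set_pmf (empirical m (\<lambda>k. S m k \<omega>)) \<subseteq> ?V"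
          using m sV by (auto simp: set_empirical)
        ultimately show False using cont[OF _ close] gt by force
      qed
      then have "\<P>(\<omega> in M m. \<bar>?Y m \<omega> - pmf_O_information b n p\<bar> > \<epsilon>) \<le> measure (M m) (\<Union>x\<in>?V. ?D x)"
        using conc(2) V by (intro finite_measure_mono) auto
      also have "\<dots> \<le> (\<Sum>x\<in>?V. measure (M m) (?D x))"
        using conc(2) V by (intro finite_measure_subadditive_finite) auto
      also have "\<dots> \<le> real (card ?V) * (2 * exp (- 2 * real m * \<delta>\<^sup>2))"
        using conc(1) by (intro sum_bounded_above)
      finally show ?thesis .
    qed
    have "(\<lambda>m. exp (- 2 * real m * \<delta>\<^sup>2)) \<longlonglongrightarrow> 0"
      using d by real_asymp
    then have "(\<lambda>m. real (card ?V) * (2 * exp (- 2 * real m * \<delta>\<^sup>2))) \<longlonglongrightarrow> 0"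
      by (intro tendsto_mult_right_zero)
    moreover have "\<forall>\<^sub>F m in sequentially. norm (\<P>(\<omega> in M m. \<bar>?Y m \<omega> - pmf_O_information b n p\<bar> > \<epsilon>))
        \<le> real (card ?V) * (2 * exp (- 2 * real m * \<delta>\<^sup>2))"
      using eventually_ge_at_top[of 1]
      by eventually_elim (simp only: real_norm_def abs_of_nonneg measure_nonneg bound)
    ultimately show "(\<lambda>m. \<P>(\<omega> in M m. \<bar>1 / real m * (\<Sum>j=2..n-1.
        gen_llr b (K_T n A j) (K_H n A j) m (\<lambda>k. S m k \<omega>)) - pmf_O_information b n p\<bar> > \<epsilon>)) \<longlonglongrightarrow> 0"
      by (rule Lim_null_comparison[rotated])
  qed
qed

end
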